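(* Let $d,q$ be positive integers and $1\le i\le d$. The graph $H(d,q,i)$ exhibits perfect state transfer (for the Grover walk) if and only if $(d,q,i)=(d,2,d)$ or $(d,q,i)=(2,2,1)$.
   Context: For a set $F$ with $q$ elements and $1\le i\le d$, $H(d,q,i)$ is the graph with vertex set $F^d$ in which two words are adjacent iff they differ in exactly $i$ coordinates. Grover walk: for a finite simple graph $G$ without isolated vertices, arcs $\mathcal{A}(G)=\{(u,v),(v,u):uv\in E(G)\}$, $t((u,v))=v$, $(u,v)^{-1}=(v,u)$; shift $S_{ab}=\delta_{a,b^{-1}}$; boundary $N_{ua}=\frac{1}{\sqrt{\deg u}}\delta_{u,t(a)}$; $U=S(2N^*N-I)$; $\Phi_u=N^*\mathbf{e}_u$. $G$ exhibits perfect state transfer if there are vertices $u\ne v$, a positive integer $\tau$ and a unimodular $\gamma\in\mathbb{C}$ with $U^\tau\Phi_u=\gamma\Phi_v$. *)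

theory Defs
  imports Complex_Main "Graph_Theory.Graph_Theory"
begin

text \<open>
  A finite simple graph is a \<^locale>\<open>pair_graph\<close>: each edge \<open>uv\<close> is represented by the two
  pairs \<open>(u, v)\<close> and \<open>(v, u)\<close>, so that \<^term>\<open>parcs G\<close> is the arc set of \<open>G\<close>.
\<close>

definition hamming_dist_graph :: "nat \<Rightarrow> 'a set \<Rightarrow> nat \<Rightarrow> 'a list pair_pre_digraph" where
  "hamming_dist_graph d F i =
     (let V = {x. length x = d \<and> set x \<subseteq> F}
      in \<lparr> pverts = V,
           parcs = {(x, y). x \<in> V \<and> y \<in> V \<and> card {k. k < d \<and> x ! k \<noteq> y ! k} = i} \<rparr>)"

text \<open>
  A matrix with finite index sets is a function of its row and column index, and a vector is a
  function of its index. Only the entries at indices in the index sets are meaningful; the index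
  set that is summed over is an explicit argument.
\<close>

type_synonym ('r, 'c) cmat = "'r \<Rightarrow> 'c \<Rightarrow> complex"
type_synonym 'r cvec = "'r \<Rightarrow> complex"

definition mat_mult :: "'k set \<Rightarrow> ('r, 'k) cmat \<Rightarrow> ('k, 'c) cmat \<Rightarrow> ('r, 'c) cmat" where
  "mat_mult K A B = (\<lambda>r c. \<Sum>k\<in>K. A r k * B k c)"

definition mat_vec :: "'k set \<Rightarrow> ('r, 'k) cmat \<Rightarrow> 'k cvec \<Rightarrow> 'r cvec" where
  "mat_vec K A v = (\<lambda>r. \<Sum>k\<in>K. A r k * v k)"

definition mat_adjoint :: "('r, 'c) cmat \<Rightarrow> ('c, 'r) cmat" where
  "mat_adjoint A = (\<lambda>c r. cnj (A r c))"

definition id_mat :: "('r, 'r) cmat" where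
  "id_mat = (\<lambda>r c. if r = c then 1 else 0)"

definition unit_vec :: "'r \<Rightarrow> 'r cvec" where
  "unit_vec u = (\<lambda>r. if r = u then 1 else 0)"

definition shift_matrix :: "('v \<times> 'v, 'v \<times> 'v) cmat" where
  "shift_matrix = (\<lambda>a b. if a = prod.swap b then 1 else 0)"

definition boundary_matrix :: "'v pair_pre_digraph \<Rightarrow> ('v, 'v \<times> 'v) cmat" where
  "boundary_matrix G =
     (\<lambda>u a. complex_of_real (1 / sqrt (real (out_degree (with_proj G) u))) *
            (if u = snd a then 1 else 0))"

definition grover_matrix :: "'v pair_pre_digraph \<Rightarrow> ('v \<times> 'v, 'v \<times> 'v) cmat" where
  "grover_matrix G =
     mat_mult (parcs G) shift_matrix
       (\<lambda>a b. 2 * mat_mult (pverts G) (mat_adjoint (boundary_matrix G)) (boundary_matrix G) a b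
              - id_mat a b)"

definition vertex_state :: "'v pair_pre_digraph \<Rightarrow> 'v \<Rightarrow> ('v \<times> 'v) cvec" where
  "vertex_state G u = mat_vec (pverts G) (mat_adjoint (boundary_matrix G)) (unit_vec u)"

text \<open>
  The power \<open>U\<^sup>\<tau>\<close> is the \<open>\<tau>\<close>-fold application of the operator \<open>U\<close>, and the vectors in
  \<open>\<complex>\<^sup>A\<close>, where \<open>A\<close> is the arc set, are compared on \<open>A\<close> only.
\<close>

definition perfect_state_transfer :: "'v pair_pre_digraph \<Rightarrow> bool" where
  "perfect_state_transfer G \<longleftrightarrow>
     (\<exists>u\<in>pverts G. \<exists>v\<in>pverts G. u \<noteq> v \<and>
       (\<exists>\<tau>::nat. \<tau> > 0 \<and>
         (\<exists>\<gamma>::complex. cmod \<gamma> = 1 \<and>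
           (\<forall>a\<in>parcs G.
              ((mat_vec (parcs G) (grover_matrix G)) ^^ \<tau>) (vertex_state G u) a
                = \<gamma> * vertex_state G v a))))"

text \<open>
  The graph is a finite simple graph, and it has no isolated vertices once the alphabet has at
  least two letters. For a one-letter alphabet it is a single isolated vertex, where perfect state
  transfer fails because there are no two distinct vertices.
\<close>

lemma pair_graph_hamming_dist_graph:
  assumes "finite F" and "1 \<le> i"
  shows "pair_graph (hamming_dist_graph d F i)"
proof -
  let ?V = "{x. length x = d \<and> set x \<subseteq> F}"
  let ?G = "hamming_dist_graph d F i"
  have fin: "finite ?V"
    using finite_lists_length_eq[OF assms(1), of d] by (simp add: conj_commute)
  have V: "pverts ?G = ?V"
    by (simp add: hamming_dist_graph_def)
  have A: "parcs ?G = {(x, y). x \<in> ?V \<and> y \<in> ?V \<and> card {k. k < d \<and> x ! k \<noteq> y ! k} = i}"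
    by (simp add: hamming_dist_graph_def)
  have sub: "parcs ?G \<subseteq> ?V \<times> ?V"
    unfolding A by blast
  have irr: "fst e \<noteq> snd e" if "e \<in> parcs ?G" for e
  proof
    assume "fst e = snd e"
    moreover have "card {k. k < d \<and> fst e ! k \<noteq> snd e ! k} = i"
      using that unfolding A by (simp add: case_prod_beta)
    ultimately show False
      using assms(2) by simp
  qed
  have sym: "sym (parcs ?G)"
  proof (rule symI)
    fix x y assume "(x, y) \<in> parcs ?G"
    moreover have "{k. k < d \<and> y ! k \<noteq> x ! k} = {k. k < d \<and> x ! k \<noteq> y ! k}"
      by auto
    ultimately show "(y, x) \<in> parcs ?G"
      unfolding A by simp
  qed
  show ?thesis
  proof unfold_locales
    show "finite (pverts ?G)" using fin V by simp
    show "finite (parcs ?G)"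
      by (rule finite_subset[OF sub]) (use fin in simp)
    show "symmetric (with_proj ?G)"
      using sym by (simp add: symmetric_def)
    fix e assume e: "e \<in> parcs ?G"
    have "e \<in> ?V \<times> ?V"
      using sub e by (rule subsetD)
    then show "fst e \<in> pverts ?G" "snd e \<in> pverts ?G"
      unfolding V mem_Times_iff by blast+
    show "fst e \<noteq> snd e"
      using e by (rule irr)
  qed
qed

lemma hamming_dist_graph_no_isolated:
  assumes "card F \<ge> 2" and "i \<le> d" and x: "x \<in> pverts (hamming_dist_graph d F i)"
  shows "\<exists>y. (x, y) \<in> parcs (hamming_dist_graph d F i)"
proof -
  have "\<exists>b\<in>F. b \<noteq> a" for a
  proof (rule ccontr)
    assume "\<not> ?thesis"
    then have "F \<subseteq> {a}"
      by blast
    then have "card F \<le> card {a}"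
      by (intro card_mono) simp_all
    then show False
      using assms(1) by simp
  qed
  then obtain g where g: "\<And>a. g a \<in> F" "\<And>a. g a \<noteq> a"
    by metis
  have xd: "length x = d" "set x \<subseteq> F"
    using x by (auto simp: hamming_dist_graph_def)
  define y where "y = map (\<lambda>k. if k < i then g (x ! k) else x ! k) [0..<d]"
  have "{k. k < d \<and> x ! k \<noteq> y ! k} = {..<i}"
  proof -
    have "x ! k \<noteq> y ! k \<longleftrightarrow> k < i" if "k < d" for k
      using that g(2)[of "x ! k"] by (simp add: y_def)
    then have "{k. k < d \<and> x ! k \<noteq> y ! k} = {k. k < d \<and> k < i}"
      by blast
    also have "\<dots> = {..<i}"
      using assms(2) by auto
    finally show ?thesis .
  qed
  moreover have "length y = d"
    by (simp add: y_def)
  moreover have "set y \<subseteq> F"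
  proof -
    have "x ! k \<in> F" if "k < d" for k
      using that xd nth_mem[of k x] by auto
    then show ?thesis
      using g(1) unfolding y_def by auto
  qed
  ultimately show ?thesis
    using xd unfolding hamming_dist_graph_def by (intro exI[of _ y]) simp
qed

end

theory Submission
  imports Defs "HOL-Computational_Algebra.Polynomial"
begin

text \<open>
  If \<open>f\<close> is an eigenfunction of the normalised adjacency matrix with eigenvalue \<open>\<theta>\<close>, then pairing
  \<open>U\<^sup>\<tau> \<Phi>\<^sub>u = \<gamma> \<Phi>\<^sub>v\<close> with \<open>f\<close> gives \<open>T\<^sub>\<tau>(\<theta>) f(u) = \<gamma> f(v)\<close>, with \<open>T\<^sub>\<tau>\<close> the Chebyshev polynomial;
  \<open>f = 1\<close> shows \<open>\<gamma> = 1\<close>. In \<open>H(d,q,i)\<close> the products \<open>f(x) = \<Prod>\<^sub>k\<^sub>\<in>\<^sub>M s(x\<^sub>k)\<close> with \<open>\<Sum> s = 0\<close> are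
  eigenfunctions whose eigenvalue depends on the size of \<open>M\<close> only. If there is a third letter \<open>c\<close>
  besides \<open>u\<^sub>k \<noteq> v\<^sub>k\<close>, then \<open>s = e\<^sub>v\<^sub>k - e\<^sub>c\<close> gives a contradiction, so \<open>q = 2\<close>. Then sign functions
  give \<open>T\<^sub>\<tau>(\<theta>\<^sub>1) = -1\<close> and \<open>T\<^sub>\<tau>(\<theta>\<^sub>2) = 1\<close> for \<open>\<theta>\<^sub>1 = 1 - 2i/d\<close> and
  \<open>\<theta>\<^sub>2 = 1 - 4i(d-i)/(d(d-1))\<close>. As \<open>2 T\<^sub>\<tau>(x/2)\<close> is monic and integral, \<open>2\<theta>\<^sub>1\<close> and \<open>2\<theta>\<^sub>2\<close> are integers,
  which leaves \<open>d | 4i\<close> and a few cases. Conversely, \<open>\<tau> = 1\<close> works for the perfect matching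
  \<open>H(d,2,d)\<close> and \<open>\<tau> = 2\<close> for the 4-cycle \<open>H(2,2,1)\<close>.
\<close>

section \<open>Chebyshev polynomials\<close>

text \<open>Chebyshev polynomials of the first kind. The ring is left general because the walk
  evaluates them at complex numbers and the arithmetic at real ones.\<close>

fun cheb :: "nat \<Rightarrow> 'a::comm_ring_1 \<Rightarrow> 'a" where
  "cheb 0 x = 1"
| "cheb (Suc 0) x = x"
| "cheb (Suc (Suc n)) x = 2 * x * cheb (Suc n) x - cheb n x"

lemma cheb_one [simp]: "cheb n 1 = 1"
  by (induction n "1::'a" rule: cheb.induct) simp_all

lemma cheb_minus: "cheb n (- x) = (- 1) ^ n * cheb n x"
  by (induction n x rule: cheb.induct) (simp_all add: algebra_simps)

lemma cheb_of_real: "cheb n (of_real x) = (of_real (cheb n x) :: 'a::{comm_ring_1,real_algebra_1})"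
  by (induction n x rule: cheb.induct) simp_all

text \<open>As -1/2 is the cosine of a third of a full turn, the values have period 3: they run
  through 1, -1/2, -1/2.\<close>

lemma cheb_minus_half_neq: "cheb n (- (1/2) :: real) \<noteq> - 1"
proof -
  have period: "cheb (n + 3) (- (1/2) :: real) = cheb n (- (1/2))" for n
    by (simp add: numeral_3_eq_3)
  have "cheb n (- (1/2) :: real) \<in> {1, - (1/2)}"
  proof (induction n rule: less_induct)
    case (less n)
    consider "n = 0" | "n = 1" | "n = 2" | "n = (n - 3) + 3" "n - 3 < n"
      by linarith
    then show ?case
    proof cases
      case 4
      then show ?thesis
        using less period by metis
    qed (simp_all add: numeral_2_eq_2)
  qed
  then show ?thesis
    by auto
qed

text \<open>For even \<open>n\<close>, parity would carry the value -1 over to the argument -1/2,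
  where it does not occur.\<close>

lemma odd_if_cheb_half: "cheb n (1/2 :: real) = - 1 \<Longrightarrow> odd n"
  using cheb_minus[of n "1/2 :: real"] cheb_minus_half_neq[of n] by auto

lemma even_if_cheb_zero: "cheb n (0 :: real) = 1 \<Longrightarrow> even n"
  using cheb_minus[of n "0 :: real"] by (cases "even n") auto

text \<open>
  As a function of \<open>2 x\<close>, the polynomial \<open>2 cheb n x\<close> is monic with integer coefficients, so that
  the rational root theorem applies.
\<close>

lemma cheb_clear_denominator:
  fixes x :: "'a::field_char_0"
  assumes x: "2 * x = of_int p / of_int r" and r: "r \<noteq> 0"
  shows "\<exists>k. of_int r ^ Suc n * (2 * cheb (Suc n) x) = of_int (p ^ Suc n + r * k)"
proof -
  have rx: "of_int r * (2 * x) = of_int p"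
    using x r by simp
  show ?thesis
  proof (induction n rule: induct_nat_012)
    case 0
    show ?case
      using rx by (intro exI[of _ 0]) simp
  next
    case 1
    have "of_int r ^ 2 * (2 * cheb 2 x) = (of_int r * (2 * x)) ^ 2 - 2 * of_int r ^ 2"
      by (simp add: numeral_2_eq_2 algebra_simps)
    then show ?case
      unfolding rx
      by (intro exI[of _ "- 2 * r"]) (simp add: numeral_2_eq_2 algebra_simps)
  next
    case (ge2 n)
    then obtain k l
      where k: "of_int r ^ Suc n * (2 * cheb (Suc n) x) = of_int (p ^ Suc n + r * k)"
        and l: "of_int r ^ Suc (Suc n) * (2 * cheb (Suc (Suc n)) x)
                  = of_int (p ^ Suc (Suc n) + r * l)"
      by blast
    have "of_int r ^ Suc (Suc (Suc n)) * (2 * cheb (Suc (Suc (Suc n))) x)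
        = (of_int r * (2 * x)) * (of_int r ^ Suc (Suc n) * (2 * cheb (Suc (Suc n)) x))
          - of_int r ^ 2 * (of_int r ^ Suc n * (2 * cheb (Suc n) x))"
      unfolding cheb.simps(3)[of "Suc n"] by (simp add: power2_eq_square algebra_simps)
    also have "\<dots> = of_int (p * (p ^ Suc (Suc n) + r * l) - r ^ 2 * (p ^ Suc n + r * k))"
      unfolding rx k l by simp
    also have "p * (p ^ Suc (Suc n) + r * l) - r ^ 2 * (p ^ Suc n + r * k)
        = p ^ Suc (Suc (Suc n)) + r * (p * l - r * (p ^ Suc n + r * k))"
      by (simp add: power2_eq_square algebra_simps)
    finally show ?case
      by blast
  qed
qed

text \<open>Write \<open>2 * x\<close> as p/r in lowest terms. Since \<open>2 * cheb n x\<close> is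
  an integer, clearing denominators makes r divide p^n, so r = 1.\<close>

lemma two_times_Ints_if_cheb:
  fixes x :: "'a::field_char_0"
  assumes "x \<in> \<rat>" and "n > 0" and "cheb n x \<in> {1, - 1}"
  shows "2 * x \<in> \<int>"
proof -
  have "2 * x \<in> \<rat>"
    using assms(1) by simp
  then obtain p r where pr: "r > 0" "coprime p r" "2 * x = of_int p / of_int r"
    by (rule Rats_cases')
  obtain m where m: "n = Suc m"
    using assms(2) gr0_conv_Suc by blast
  obtain k where k: "of_int r ^ n * (2 * cheb n x) = (of_int (p ^ n + r * k) :: 'a)"
    using cheb_clear_denominator[OF pr(3), of m] pr(1) m by auto
  obtain e :: int where e: "cheb n x = of_int e"
    using assms(3) by (metis insertE of_int_1 of_int_minus singletonD)
  have "(of_int (r ^ n * (2 * e)) :: 'a) = of_int (p ^ n + r * k)"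
    using k unfolding e by simp
  then have "r ^ n * (2 * e) = p ^ n + r * k"
    by (simp only: of_int_eq_iff)
  then have "p ^ n = r * (r ^ m * (2 * e) - k)"
    unfolding m by (simp add: algebra_simps)
  then have "r dvd p ^ n"
    by simp
  moreover have "coprime (p ^ n) r"
    using pr(2) by simp
  ultimately have "is_unit r"
    by (meson coprime_common_divisor dvd_refl)
  then have "r = 1"
    using pr(1) by simp
  then show ?thesis
    using pr(3) by simp
qed

section \<open>The Grover walk on a regular graph\<close>

context
  fixes G :: "'v pair_pre_digraph"
  assumes G: "pair_graph G"
begin

interpretation pair_graph G
  by (rule G)

lemma swap_in_parcs: "prod.swap a \<in> parcs G \<longleftrightarrow> a \<in> parcs G"
  using arcs_symmetric by (cases a) auto

lemma sum_parcs_swap: "(\<Sum>a\<in>parcs G. h (prod.swap a)) = (\<Sum>a\<in>parcs G. h a)"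
  by (rule sum.reindex_bij_witness[of _ prod.swap prod.swap]) (simp_all add: swap_in_parcs)

lemma sum_parcs: "(\<Sum>a\<in>parcs G. h a) = (\<Sum>x\<in>pverts G. \<Sum>y | (x, y) \<in> parcs G. h (x, y))"
proof -
  have "parcs G = (SIGMA x:pverts G. {y. (x, y) \<in> parcs G})"
    using in_arcsD1 by auto
  moreover have "finite {y. (x, y) \<in> parcs G}" for x
    by (rule finite_subset[of _ "snd ` parcs G"]) force+
  ultimately show ?thesis
    using sum.Sigma[of "pverts G" "\<lambda>x. {y. (x, y) \<in> parcs G}" "\<lambda>x y. h (x, y)"]
    by simp
qed

lemma sum_out_parcs: "(\<Sum>a | a \<in> parcs G \<and> fst a = x. h a) = (\<Sum>y | (x, y) \<in> parcs G. h (x, y))"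
  by (rule sum.reindex_bij_witness[of _ "\<lambda>y. (x, y)" snd]) auto

lemma sum_in_parcs: "(\<Sum>a | a \<in> parcs G \<and> snd a = x. h a) = (\<Sum>y | (x, y) \<in> parcs G. h (y, x))"
  by (rule sum.reindex_bij_witness[of _ "\<lambda>y. (y, x)" fst]) (auto intro: arcs_symmetric)

lemma out_degree_eq_card: "out_degree (with_proj G) x = card {y. (x, y) \<in> parcs G}"
  using sum_out_parcs[where x = x and h = "\<lambda>_. 1::nat"] by (simp add: out_degree_def out_arcs_def)

lemma vertex_state_eq:
  assumes "u \<in> pverts G"
  shows "vertex_state G u a =
    (if snd a = u then 1 / complex_of_real (sqrt (out_degree (with_proj G) u)) else 0)"
  using assms
  by (simp add: vertex_state_def mat_vec_def mat_adjoint_def boundary_matrix_def unit_vec_def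
      if_distrib[of "\<lambda>x. _ * x"] cong: if_cong)

text \<open>The shift makes row \<open>a\<close> of U the row \<open>prod.swap a\<close> of 2 N* N -
  I. The entry of N* N at two arcs is the reciprocal degree of their common head, or 0 if the heads
  differ, and \<open>prod.swap a\<close> has head \<open>fst a\<close>.\<close>

lemma grover_step:
  assumes a: "a \<in> parcs G"
  shows "mat_vec (parcs G) (grover_matrix G) \<psi> a =
    2 / of_nat (out_degree (with_proj G) (fst a)) * (\<Sum>b | b \<in> parcs G \<and> snd b = fst a. \<psi> b)
      - \<psi> (prod.swap a)"
proof -
  let ?K = "\<lambda>u. out_degree (with_proj G) u"
  have sw: "prod.swap a \<in> parcs G"
    using a by (simp add: swap_in_parcs)
  have fa: "fst a \<in> pverts G"
    using a by (rule arc_fst_in_verts)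
  define r where "r = (\<lambda>u. complex_of_real (1 / sqrt (?K u)))"
  have N: "boundary_matrix G u b = r u * (if u = snd b then 1 else 0)" for u b
    by (simp add: boundary_matrix_def r_def)
  have cnj_r: "cnj (r u) = r u" for u
    by (simp add: r_def)
  have r_sq: "r u * r u = 1 / of_nat (?K u)" for u
    by (simp add: r_def flip: of_real_mult)
  have NN: "mat_mult (pverts G) (mat_adjoint (boundary_matrix G)) (boundary_matrix G) (prod.swap a) b
      = (if snd b = fst a then 1 / of_nat (?K (fst a)) else 0)" for b
  proof -
    have "mat_mult (pverts G) (mat_adjoint (boundary_matrix G)) (boundary_matrix G) (prod.swap a) b
      = (\<Sum>u\<in>pverts G. if u = fst a then r u * r u * (if snd b = u then 1 else 0) else 0)"
      unfolding mat_mult_def mat_adjoint_def N by (intro sum.cong) (auto simp: cnj_r)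
    then show ?thesis
      using fa by (simp add: r_sq)
  qed
  have row: "grover_matrix G a b = 2 * (if snd b = fst a then 1 / of_nat (?K (fst a)) else 0)
      - (if b = prod.swap a then 1 else 0)" for b
  proof -
    have shift: "(shift_matrix :: ('v \<times> 'v, 'v \<times> 'v) cmat) a c = (if c = prod.swap a then 1 else 0)" for c
      by (auto simp: shift_matrix_def)
    have "grover_matrix G a b = (\<Sum>c\<in>parcs G. if c = prod.swap a then
       2 * mat_mult (pverts G) (mat_adjoint (boundary_matrix G)) (boundary_matrix G) c b
              - id_mat c b else 0)"
      unfolding grover_matrix_def mat_mult_def[of "parcs G"] shift
      by (intro sum.cong) auto
    then show ?thesis
      using sw by (simp add: NN id_mat_def eq_commute[of b])
  qed
  have "mat_vec (parcs G) (grover_matrix G) \<psi> a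
      = (\<Sum>b\<in>parcs G. (if snd b = fst a then 2 / of_nat (?K (fst a)) * \<psi> b else 0)
           - (if b = prod.swap a then \<psi> b else 0))"
    unfolding mat_vec_def row by (intro sum.cong) (auto simp: algebra_simps)
  also have "\<dots> = (\<Sum>b\<in>parcs G. if snd b = fst a then 2 / of_nat (?K (fst a)) * \<psi> b else 0)
      - \<psi> (prod.swap a)"
    using sw by (simp add: sum_subtractf)
  also have "(\<Sum>b\<in>parcs G. if snd b = fst a then 2 / of_nat (?K (fst a)) * \<psi> b else 0)
      = 2 / of_nat (?K (fst a)) * (\<Sum>b | b \<in> parcs G \<and> snd b = fst a. \<psi> b)"
    unfolding sum_distrib_left by (rule sum.inter_filter[symmetric]) simp
  finally show ?thesis .
qed

context
  fixes K :: nat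
  assumes K: "\<And>x. x \<in> pverts G \<Longrightarrow> out_degree (with_proj G) x = K" and K_pos: "K > 0"
begin

text \<open>Since N N* = I, the state of \<open>u\<close> is fixed by 2 N* N - I, and the shift then
  turns the arcs into \<open>u\<close> around.\<close>

lemma grover_vertex_state:
  assumes u: "u \<in> pverts G" and a: "a \<in> parcs G"
  shows "mat_vec (parcs G) (grover_matrix G) (vertex_state G u) a
    = (if fst a = u then 1 / complex_of_real (sqrt K) else 0)"
proof -
  have "(\<Sum>b | b \<in> parcs G \<and> snd b = fst a. vertex_state G u b)
      = (if fst a = u then of_nat K / complex_of_real (sqrt K) else 0)"
    unfolding sum_in_parcs vertex_state_eq[OF u]
    using K[OF u] out_degree_eq_card[of u] by auto
  then show ?thesis
    unfolding grover_step[OF a] using K[OF arc_fst_in_verts[OF a]] K_pos vertex_state_eq[OF u] K[OF u]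
    by (auto simp: field_simps)
qed

text \<open>After one step exactly one arc into each neighbour of \<open>u\<close> carries weight.
  The second step spreads it with coefficient 2/K over the arcs leaving that neighbour and subtracts
  the reflected part on the arcs back to \<open>u\<close>.\<close>

lemma grover_grover_vertex_state:
  assumes u: "u \<in> pverts G" and a: "a \<in> parcs G"
  shows "mat_vec (parcs G) (grover_matrix G) (mat_vec (parcs G) (grover_matrix G) (vertex_state G u)) a
    = ((if (u, fst a) \<in> parcs G then 2 / of_nat K else 0) - (if snd a = u then 1 else 0))
      / complex_of_real (sqrt K)"
proof -
  let ?U = "mat_vec (parcs G) (grover_matrix G)"
  have fin: "finite {y. (x, y) \<in> parcs G}" for x
    by (rule finite_subset[of _ "snd ` parcs G"]) force+
  have "(\<Sum>b | b \<in> parcs G \<and> snd b = fst a. ?U (vertex_state G u) b)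
      = (\<Sum>b | b \<in> parcs G \<and> snd b = fst a. if fst b = u then 1 / complex_of_real (sqrt K) else 0)"
    by (intro sum.cong) (simp_all add: grover_vertex_state[OF u])
  also have "\<dots> = (if (u, fst a) \<in> parcs G then 1 / complex_of_real (sqrt K) else 0)"
    unfolding sum_in_parcs using fin arcs_symmetric by auto
  finally show ?thesis
    unfolding grover_step[OF a]
    using K[OF arc_fst_in_verts[OF a]] a grover_vertex_state[OF u, of "prod.swap a"]
    by (simp add: swap_in_parcs diff_divide_distrib)
qed

text \<open>
  The pairings of \<open>U\<^sup>n \<Phi>\<^sub>u\<close> with the two lifts \<open>f \<circ> snd\<close> and \<open>f \<circ> fst\<close> of an eigenfunction \<open>f\<close>
  to the arcs satisfy a two-term recursion, which is that of the Chebyshev polynomials.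
\<close>

lemma grover_power_pairing:
  fixes f :: "'v \<Rightarrow> complex"
  assumes u: "u \<in> pverts G"
    and f: "\<And>x. x \<in> pverts G \<Longrightarrow> (\<Sum>y | (x, y) \<in> parcs G. f y) = of_nat K * \<theta> * f x"
  shows "(\<Sum>a\<in>parcs G. f (snd a) * (mat_vec (parcs G) (grover_matrix G) ^^ n) (vertex_state G u) a)
    = of_real (sqrt K) * cheb n \<theta> * f u"
proof -
  define U where "U = mat_vec (parcs G) (grover_matrix G)"
  define P where "P = (\<lambda>\<psi>. \<Sum>a\<in>parcs G. f (snd a) * \<psi> a)"
  define Q where "Q = (\<lambda>\<psi>. \<Sum>a\<in>parcs G. f (fst a) * \<psi> a)"
  have U: "U \<psi> a = 2 / of_nat K * (\<Sum>b | b \<in> parcs G \<and> snd b = fst a. \<psi> b) - \<psi> (prod.swap a)"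
    if "a \<in> parcs G" for \<psi> a
    unfolding U_def using grover_step[OF that] K[OF arc_fst_in_verts[OF that]] by simp
  have card: "of_nat (card {y. (x, y) \<in> parcs G}) = (of_nat K :: complex)" if "x \<in> pverts G" for x
    using K[OF that] out_degree_eq_card[of x] by simp
  \<comment> \<open>The inner sum of \<open>g\<close> over the arcs leaving x is K \<theta> f(x) for
    the lift by \<open>snd\<close>, by the eigenvalue equation, and K f(x) for the lift by
    \<open>fst\<close>, by regularity. The swap exchanges the two lifts.\<close>
  have pairing: "(\<Sum>a\<in>parcs G. g a * U \<psi> a) = (\<Sum>x\<in>pverts G. 
        2 / of_nat K * (\<Sum>y | (x, y) \<in> parcs G. g (x, y)) * (\<Sum>b | b \<in> parcs G \<and> snd b = x. \<psi> b))
     - (\<Sum>a\<in>parcs G. g (prod.swap a) * \<psi> a)" for g \<psi>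
  proof -
    have "(\<Sum>a\<in>parcs G. g a * U \<psi> a)
        = (\<Sum>a\<in>parcs G. g a * (2 / of_nat K * (\<Sum>b | b \<in> parcs G \<and> snd b = fst a. \<psi> b)))
          - (\<Sum>a\<in>parcs G. g a * \<psi> (prod.swap a))"
      unfolding sum_subtractf[symmetric] by (intro sum.cong) (simp_all add: U algebra_simps)
    also have "(\<Sum>a\<in>parcs G. g a * \<psi> (prod.swap a)) = (\<Sum>a\<in>parcs G. g (prod.swap a) * \<psi> a)"
      using sum_parcs_swap[of "\<lambda>a. g (prod.swap a) * \<psi> a"] by simp
    finally show ?thesis
      unfolding sum_parcs[of "\<lambda>a. g a * (2 / of_nat K * _ a)"]
      by (simp add: sum_distrib_left sum_distrib_right mult_ac)
  qed
  have regroup: "(\<Sum>x\<in>pverts G. f x * (\<Sum>b | b \<in> parcs G \<and> snd b = x. \<psi> b)) = P \<psi>" for \<psi>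
  proof -
    have "P \<psi> = (\<Sum>a\<in>parcs G. f (fst a) * \<psi> (prod.swap a))"
      unfolding P_def using sum_parcs_swap[of "\<lambda>a. f (snd a) * \<psi> a"] by simp
    then show ?thesis
      unfolding sum_in_parcs by (simp add: sum_parcs sum_distrib_left)
  qed
  have PU: "P (U \<psi>) = 2 * \<theta> * P \<psi> - Q \<psi>" for \<psi>
  proof -
    have "P (U \<psi>) = (\<Sum>x\<in>pverts G. 2 * \<theta> * (f x * (\<Sum>b | b \<in> parcs G \<and> snd b = x. \<psi> b))) - Q \<psi>"
      unfolding P_def pairing Q_def using K_pos by (simp add: f mult_ac)
    then show ?thesis
      by (simp add: sum_distrib_left[symmetric] regroup)
  qed
  have QU: "Q (U \<psi>) = P \<psi>" for \<psi>
  proof -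
    have "Q (U \<psi>) = (\<Sum>x\<in>pverts G. 2 * (f x * (\<Sum>b | b \<in> parcs G \<and> snd b = x. \<psi> b))) - P \<psi>"
      unfolding Q_def pairing P_def using K_pos by (simp add: card mult_ac)
    then show ?thesis
      by (simp add: sum_distrib_left[symmetric] regroup)
  qed
  have start: "(\<Sum>a\<in>parcs G. g a * vertex_state G u a)
      = (\<Sum>y | (u, y) \<in> parcs G. g (y, u)) / of_real (sqrt K)" for g
  proof -
    have "(\<Sum>a\<in>parcs G. g a * vertex_state G u a)
        = (\<Sum>a\<in>parcs G. if snd a = u then g a / of_real (sqrt K) else 0)"
      by (intro sum.cong) (auto simp: vertex_state_eq[OF u] K[OF u])
    also have "\<dots> = (\<Sum>a | a \<in> parcs G \<and> snd a = u. g a / of_real (sqrt K))"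
      by (simp add: sum.inter_filter)
    finally show ?thesis
      by (simp add: sum_in_parcs sum_divide_distrib)
  qed
  have sqrt: "of_nat K / complex_of_real (sqrt K) = of_real (sqrt K)"
    using real_div_sqrt[of K] by (metis of_nat_0_le_iff of_real_divide of_real_of_nat_eq)
  have P0: "P (vertex_state G u) = of_real (sqrt K) * f u"
    unfolding P_def start
    by (simp add: card[OF u] sqrt flip: times_divide_eq_left del: times_divide_eq_left)
  \<comment> \<open>With \<open>PU\<close> and \<open>P0\<close> this gives 2 \<theta> - \<theta> =
    \<theta> after one step, so the recursion has the initial values 1 and \<theta>.\<close>
  have Q0: "Q (vertex_state G u) = of_real (sqrt K) * \<theta> * f u"
    unfolding Q_def start
    by (simp add: f[OF u] sqrt flip: times_divide_eq_left del: times_divide_eq_left)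
  have "P ((U ^^ n) (vertex_state G u)) = of_real (sqrt K) * cheb n \<theta> * f u"
  proof (induction n rule: induct_nat_012)
    case 0
    show ?case by (simp add: P0)
  next
    case 1
    show ?case by (simp add: PU P0 Q0 algebra_simps)
  next
    case (ge2 n)
    then show ?case by (simp add: PU QU algebra_simps)
  qed
  then show ?thesis
    by (simp add: P_def U_def)
qed

lemma perfect_state_transfer_cheb:
  fixes f :: "'v \<Rightarrow> complex"
  assumes u: "u \<in> pverts G" and v: "v \<in> pverts G"
    and pst: "\<And>a. a \<in> parcs G \<Longrightarrow>
      (mat_vec (parcs G) (grover_matrix G) ^^ n) (vertex_state G u) a = \<gamma> * vertex_state G v a"
    and f: "\<And>x. x \<in> pverts G \<Longrightarrow> (\<Sum>y | (x, y) \<in> parcs G. f y) = of_nat K * \<theta> * f x"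
  shows "cheb n \<theta> * f u = \<gamma> * f v"
proof -
  have "of_real (sqrt K) * cheb n \<theta> * f u = (\<Sum>a\<in>parcs G. f (snd a) * (\<gamma> * vertex_state G v a))"
    using grover_power_pairing[OF u f, of n] by (simp add: pst)
  \<comment> \<open>The power 0 is inserted so that \<open>grover_power_pairing\<close> also
    evaluates the side of \<open>v\<close>.\<close>
  also have "\<dots> = \<gamma> * (\<Sum>a\<in>parcs G. f (snd a) * (mat_vec (parcs G) (grover_matrix G) ^^ 0) (vertex_state G v) a)"
    by (simp add: sum_distrib_left mult_ac)
  also have "\<dots> = of_real (sqrt K) * (\<gamma> * f v)"
    using grover_power_pairing[OF v f, of 0] by simp
  finally show ?thesis
    using K_pos by simp
qed

end

end


section \<open>Eigenfunctions of the Hamming graphs\<close>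

text \<open>Distributivity, by splitting off the first letter. With monomials as factors it becomes
  a generating function over words.\<close>

lemma sum_lists_prod:
  fixes h :: "nat \<Rightarrow> 'b \<Rightarrow> 'c::comm_semiring_1"
  shows "(\<Sum>y | set y \<subseteq> F \<and> length y = d. \<Prod>k<d. h k (y ! k)) = (\<Prod>k<d. \<Sum>c\<in>F. h k c)"
proof (induction d arbitrary: h)
  case 0
  have "{y. set y \<subseteq> F \<and> length y = 0} = {[]}"
    by auto
  then show ?case
    by simp
next
  case (Suc d)
  let ?L = "{y. set y \<subseteq> F \<and> length y = d}"
  have "(\<Sum>y | set y \<subseteq> F \<and> length y = Suc d. \<Prod>k<Suc d. h k (y ! k))
      = (\<Sum>(y, c)\<in>?L \<times> F. h 0 c * (\<Prod>k<d. h (Suc k) (y ! k)))"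
    unfolding lists_length_Suc_eq
    by (subst sum.reindex)
      (auto simp: inj_on_def prod.lessThan_Suc_shift case_prod_beta simp del: prod.lessThan_Suc intro!: sum.cong)
  also have "\<dots> = (\<Sum>c\<in>F. h 0 c) * (\<Sum>y\<in>?L. \<Prod>k<d. h (Suc k) (y ! k))"
    unfolding sum.cartesian_product[symmetric]
    by (simp add: sum_distrib_left sum_distrib_right)
  finally show ?case
    using Suc.IH[of "\<lambda>k. h (Suc k)"] by (simp add: prod.lessThan_Suc_shift del: prod.lessThan_Suc)
qed

lemma prod_monom: "finite I \<Longrightarrow> (\<Prod>k\<in>I. monom (a k) (n k)) = monom (\<Prod>k\<in>I. a k) (\<Sum>k\<in>I. n k)"
  by (induction I rule: finite_induct) (simp_all add: mult_monom one_pCons monom_0)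

lemma coeff_one_minus_X_mult:
  "coeff ([:1, - 1:] * p) (Suc n) = coeff p (Suc n) - coeff (p :: 'a::comm_ring_1 poly) n"
  by simp

lemma real_Suc_times_binomial: "real (Suc n) * real (n choose k) = (real (Suc n) - real k) * real (Suc n choose k)"
proof (cases "k \<le> Suc n")
  case True
  have "real ((Suc n - k) * (Suc n choose k)) = real (Suc n * (n choose k))"
    using binomial_absorb_comp[of "Suc n" k] by simp
  then show ?thesis
    by (simp only: of_nat_mult of_nat_diff[OF True])
next
  case False
  then show ?thesis
    by (simp add: binomial_eq_0)
qed

lemma real_Suc_times_binomial_Suc:
  "real (Suc n) * real (n choose k) = real (Suc k) * real (Suc n choose Suc k)"
  using Suc_times_binomial_eq[of n k] by (metis of_nat_mult mult.commute)

lemma parcs_hamming_dist_graph: "(x, y) \<in> parcs (hamming_dist_graph d F i) \<longleftrightarrow>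
    x \<in> pverts (hamming_dist_graph d F i) \<and> y \<in> pverts (hamming_dist_graph d F i) \<and>
    card {k. k < d \<and> x ! k \<noteq> y ! k} = i"
  by (simp add: hamming_dist_graph_def)

lemma pverts_hamming_dist_graph:
  "pverts (hamming_dist_graph d F i) = {y. set y \<subseteq> F \<and> length y = d}"
  by (auto simp: hamming_dist_graph_def)

text \<open>The indeterminate marks the coordinates in which y differs from x: in coordinate k the
  letter \<open>x ! k\<close> contributes the constant term and all other letters the linear one.
  The coefficient at \<open>i\<close> then selects the words at distance \<open>i\<close>.\<close>

lemma sum_neighbours_prod:
  fixes g :: "nat \<Rightarrow> 'b \<Rightarrow> real"
  assumes F: "finite F" and x: "x \<in> pverts (hamming_dist_graph d F i)"
  shows "(\<Sum>y | (x, y) \<in> parcs (hamming_dist_graph d F i). \<Prod>k<d. g k (y ! k))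
    = coeff (\<Prod>k<d. [:g k (x ! k), (\<Sum>c\<in>F. g k c) - g k (x ! k):]) i"
proof -
  let ?V = "{y. set y \<subseteq> F \<and> length y = d}"
  let ?D = "\<lambda>y. card {k. k < d \<and> x ! k \<noteq> y ! k}"
  have xk: "x ! k \<in> F" if "k < d" for k
    using x that by (auto simp: pverts_hamming_dist_graph)
  have factor: "[:g k (x ! k), (\<Sum>c\<in>F. g k c) - g k (x ! k):]
      = (\<Sum>c\<in>F. monom (g k c) (if x ! k \<noteq> c then 1 else 0))" if "k < d" for k
  proof -
    have "(\<Sum>c\<in>F. monom (g k c) (if x ! k \<noteq> c then 1 else 0))
        = [:g k (x ! k):] + (\<Sum>c\<in>F - {x ! k}. monom (g k c) 1)"
      using xk[OF that] F by (auto simp: sum.remove monom_0 intro!: sum.cong split: if_splits)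
    also have "(\<Sum>c\<in>F - {x ! k}. monom (g k c) 1) = monom (\<Sum>c\<in>F - {x ! k}. g k c) 1"
      by (simp add: poly_eq_iff coeff_sum)
    also have "(\<Sum>c\<in>F - {x ! k}. g k c) = (\<Sum>c\<in>F. g k c) - g k (x ! k)"
      using xk[OF that] F by (simp add: sum_diff1)
    finally show ?thesis
      by (simp add: monom_Suc monom_0)
  qed
  have "(\<Prod>k<d. [:g k (x ! k), (\<Sum>c\<in>F. g k c) - g k (x ! k):])
      = (\<Prod>k<d. \<Sum>c\<in>F. monom (g k c) (if x ! k \<noteq> c then 1 else 0))"
    using factor by (intro prod.cong) auto
  also have "\<dots> = (\<Sum>y\<in>?V. \<Prod>k<d. monom (g k (y ! k)) (if x ! k \<noteq> y ! k then 1 else 0))"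
    by (rule sum_lists_prod[symmetric])
  also have "\<dots> = (\<Sum>y\<in>?V. monom (\<Prod>k<d. g k (y ! k)) (?D y))"
    by (intro sum.cong) (simp_all add: prod_monom sum.If_cases Int_def)
  finally have "coeff (\<Prod>k<d. [:g k (x ! k), (\<Sum>c\<in>F. g k c) - g k (x ! k):]) i
      = (\<Sum>y\<in>?V. if ?D y = i then (\<Prod>k<d. g k (y ! k)) else 0)"
    by (simp add: coeff_sum)
  also have "\<dots> = (\<Sum>y | y \<in> ?V \<and> ?D y = i. \<Prod>k<d. g k (y ! k))"
    by (rule sum.inter_filter[symmetric]) (rule finite_lists_length_eq[OF F])
  also have "{y. y \<in> ?V \<and> ?D y = i} = {y. (x, y) \<in> parcs (hamming_dist_graph d F i)}"
    using x by (auto simp: parcs_hamming_dist_graph pverts_hamming_dist_graph)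
  finally show ?thesis ..
qed

text \<open>The generating function replaces the usual alternating sum because it is the form in
  which neighbour sums arise. Here \<open>w\<close> is the number of coordinates that enter the
  eigenfunction, and \<open>w = 0\<close> gives the degree of the graph.\<close>

definition krawtchouk :: "nat \<Rightarrow> nat \<Rightarrow> nat \<Rightarrow> nat \<Rightarrow> real" where
  "krawtchouk d q i w = coeff ([:1, - 1:] ^ w * [:1, real q - 1:] ^ (d - w)) i"

text \<open>A coordinate in \<open>M\<close> has letter sum 0 and yields the factor s(x_k) (1 - X).
  A coordinate outside \<open>M\<close> carries the constant 1 and yields 1 + (q - 1) X.\<close>

lemma sum_neighbours_krawtchouk:
  fixes s :: "'b \<Rightarrow> real"
  assumes F: "finite F" and x: "x \<in> pverts (hamming_dist_graph d F i)"
    and s: "(\<Sum>c\<in>F. s c) = 0" and M: "M \<subseteq> {..<d}"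
  shows "(\<Sum>y | (x, y) \<in> parcs (hamming_dist_graph d F i). \<Prod>k\<in>M. s (y ! k))
    = krawtchouk d (card F) i (card M) * (\<Prod>k\<in>M. s (x ! k))"
proof -
  define g where "g = (\<lambda>k c. if k \<in> M then s c else 1)"
  have fin: "finite M"
    using M finite_subset by blast
  have split: "(\<Prod>k<d. if k \<in> M then p k else r k) = (\<Prod>k\<in>M. p k) * (\<Prod>k\<in>{..<d} - M. r k)"
    for p r :: "nat \<Rightarrow> 'c::comm_monoid_mult"
    using M by (simp add: prod.If_cases Int_absorb1 Diff_eq)
  have prod_g: "(\<Prod>k<d. g k (y ! k)) = (\<Prod>k\<in>M. s (y ! k))" for y
    unfolding g_def by (simp add: split)
  have "(\<Prod>k<d. [:g k (x ! k), (\<Sum>c\<in>F. g k c) - g k (x ! k):])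
      = (\<Prod>k<d. if k \<in> M then smult (s (x ! k)) [:1, - 1:] else [:1, real (card F) - 1:])"
    by (intro prod.cong) (simp_all add: g_def s)
  also have "\<dots> = smult (\<Prod>k\<in>M. s (x ! k))
      ([:1, - 1:] ^ card M * [:1, real (card F) - 1:] ^ (d - card M))"
    unfolding split using M fin by (simp add: prod_smult card_Diff_subset del: smult_pCons)
  finally show ?thesis
    unfolding prod_g[symmetric] sum_neighbours_prod[OF F x] by (simp add: krawtchouk_def prod_g)
qed

section \<open>Krawtchouk values for two letters\<close>

lemma krawtchouk_2_0: "i \<le> d \<Longrightarrow> krawtchouk d 2 i 0 = real (d choose i)"
  by (simp add: krawtchouk_def coeff_linear_poly_power)

lemma coeff_binomial: "coeff ([:1, 1:] ^ n :: real poly) k = real (n choose k)"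
proof (cases "k \<le> n")
  case False
  then have "degree ([:1, 1:] ^ n :: real poly) < k"
    by (metis degree_linear_power not_le_imp_less)
  then show ?thesis
    using False by (simp add: coeff_eq_0)
qed (simp add: coeff_linear_poly_power)

text \<open>In (1 - X) (1 + X)^(d-1) the coefficient is a difference of two binomials of order d -
  1. The factor \<open>d\<close> lets absorption turn both into multiples of
  \<open>d choose i\<close>.\<close>

lemma krawtchouk_2_1:
  assumes "1 \<le> i" and "d > 0"
  shows "real d * krawtchouk d 2 i 1 = (real d - 2 * real i) * real (d choose i)"
proof -
  obtain n j where [simp]: "d = Suc n" "i = Suc j"
    using assms by (metis Suc_le_D gr0_conv_Suc One_nat_def)
  have "krawtchouk d 2 i 1 = real (n choose Suc j) - real (n choose j)"
    by (simp add: krawtchouk_def coeff_one_minus_X_mult coeff_binomial del: mult_pCons_left)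
  then have "real d * krawtchouk d 2 i 1
      = real (Suc n) * real (n choose Suc j) - real (Suc n) * real (n choose j)"
    by (simp only: right_diff_distrib \<open>d = Suc n\<close>)
  then show ?thesis
    unfolding real_Suc_times_binomial[of n "Suc j"] real_Suc_times_binomial_Suc[of n j]
    by (simp add: algebra_simps del: binomial_Suc_Suc)
qed

text \<open>The same for (1 - X)^2 (1 + X)^(d-2), with absorption applied twice: from order d - 2 to
  d - 1 (fact \<open>c\<close>) and from there to d (facts \<open>a\<close> and
  \<open>b\<close>).\<close>

lemma krawtchouk_2_2:
  assumes "1 \<le> i" and "d > 1"
  shows "real d * (real d - 1) * krawtchouk d 2 i 2
    = (real d * (real d - 1) - 4 * real i * (real d - real i)) * real (d choose i)"
proof -
  obtain n j where [simp]: "d = Suc (Suc n)" "i = Suc j"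
    using assms by (metis Suc_le_D less_imp_Suc_add One_nat_def plus_1_eq_Suc add_Suc)
  define a b c e where "a = real (Suc n choose Suc j)" "b = real (Suc n choose j)"
    "c = krawtchouk d 2 i 2" "e = real (d choose i)"
  have a: "real d * a = (real d - real i) * e" and b: "real d * b = real i * e"
    using real_Suc_times_binomial[of "Suc n" "Suc j"] real_Suc_times_binomial_Suc[of "Suc n" j]
    by (simp_all add: a_b_c_e_def del: binomial_Suc_Suc)
  have c: "(real d - 1) * c = (real d - 1 - 2 * real i) * a - (real d + 1 - 2 * real i) * b"
  \<comment> \<open>For \<open>i = 1\<close> the expansion has no term of index i - 2, so this case
    is separate.\<close>
  proof (cases j)
    case 0
    have c: "c = real n - 2"
      unfolding a_b_c_e_def krawtchouk_def
      by (simp add: 0 coeff_binomial power2_eq_square)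
    show ?thesis
      unfolding c
      by (simp add: a_b_c_e_def 0 algebra_simps)
  next
    case (Suc l)
    have c: "c = real (n choose Suc j) - 2 * real (n choose j) + real (n choose l)"
      unfolding a_b_c_e_def krawtchouk_def
      by (simp add: Suc coeff_binomial power2_eq_square)
    have "real (Suc n) * c = real (Suc n) * real (n choose Suc j)
        - real (Suc n) * real (n choose j) - real (Suc n) * real (n choose j)
        + real (Suc n) * real (n choose l)"
      unfolding c by (simp add: algebra_simps)
    also have "\<dots> = (real (Suc n) - real (Suc j)) * a - real (Suc j) * a
        - (real (Suc n) - real j) * b + real j * b"
      using real_Suc_times_binomial[of n "Suc j"] real_Suc_times_binomial_Suc[of n j]
        real_Suc_times_binomial[of n j] real_Suc_times_binomial_Suc[of n l]
      by (simp only: a_b_c_e_def Suc)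
    finally show ?thesis
      by (simp add: algebra_simps)
  qed
  have "real d * (real d - 1) * c
      = (real d - 1 - 2 * real i) * (real d * a) - (real d + 1 - 2 * real i) * (real d * b)"
    using c by (simp only: mult.assoc) (simp add: algebra_simps)
  also have "\<dots> = (real d * (real d - 1) - 4 * real i * (real d - real i)) * e"
    unfolding a b by (simp add: algebra_simps)
  finally show ?thesis
    unfolding a_b_c_e_def .
qed

section \<open>Perfect state transfer\<close>

text \<open>Integrality of twice the first argument makes z = 4i/d an integer, and 1 \<le> i \<le> d
  leaves z = 1, 2, 3, 4. The value z = 4 means \<open>i = d\<close>.\<close>

lemma cheb_hamming_arithmetic:
  fixes d i n :: nat
  assumes i: "1 \<le> i" "i \<le> d" and n: "n > 0"
    and one: "cheb n (1 - 2 * real i / real d) = - 1"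
    and two: "d > 1 \<Longrightarrow>
      cheb n (1 - 4 * real i * (real d - real i) / (real d * (real d - 1))) = 1"
  shows "i = d \<or> d = 2 \<and> i = 1"
proof -
  have d: "d > 0"
    using i by simp
  have "2 * (1 - 2 * real i / real d) \<in> \<int>"
    using one n by (intro two_times_Ints_if_cheb[of _ n]) simp_all
  then have "2 - 2 * (1 - 2 * real i / real d) \<in> \<int>"
    by (intro Ints_diff) simp_all
  then obtain z :: int where z: "2 - 2 * (1 - 2 * real i / real d) = of_int z"
    by (rule Ints_cases)
  have "4 * real i = of_int z * real d"
    using z d by (simp add: field_simps)
  then have "real_of_int (4 * int i) = real_of_int (z * int d)"
    by simp
  then have z_eq: "4 * int i = z * int d"
    by (simp only: of_int_eq_iff)
  have "z > 0"
  proof (rule ccontr)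
    assume "\<not> z > 0"
    then have "z * int d \<le> 0"
      by (intro mult_nonpos_nonneg) auto
    then show False
      using z_eq i by linarith
  qed
  moreover have "z \<le> 4"
  proof (rule ccontr)
    assume "\<not> z \<le> 4"
    then have "z * int d \<ge> 5 * int d"
      by (intro mult_right_mono) auto
    then show False
      using z_eq i d by linarith
  qed
  ultimately consider "z = 1" | "z = 2" | "z = 3" | "z = 4"
    by linarith
  then show ?thesis
  proof cases
    \<comment> \<open>A parity conflict: the first argument is 1/2, which forces \<open>n\<close>
      odd. Twice the second is an integer in [0, 1), so it is 0, which forces \<open>n\<close>
      even.\<close>
    case 1
    then have "4 * int i = int d"
      using z_eq by simp
    then have "d = 4 * i"
      by linarith
    then have di: "real d = 4 * real i" and gt: "d > 1"
      using i by simp_all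
    then have "1 - 2 * real i / real d = 1/2"
      using i by simp
    then have "odd n"
      using one odd_if_cheb_half by metis
    define t where "t = 1 - 4 * real i * (real d - real i) / (real d * (real d - 1))"
    have t: "t = (real i - 1) / (4 * real i - 1)"
      using i unfolding t_def di by (simp add: field_simps)
    have ct: "cheb n t = 1"
      using two[OF gt] by (simp add: t_def)
    have "2 * t \<in> \<int>"
      using ct n by (intro two_times_Ints_if_cheb[of _ n]) (simp_all add: t)
    moreover have "0 \<le> 2 * t" "2 * t < 1"
      using i by (simp_all add: t field_simps)
    ultimately have "t = 0"
      by (auto elim!: Ints_cases)
    then have "even n"
      using ct even_if_cheb_zero by simp
    then show ?thesis
      using \<open>odd n\<close> by simp
  next
    \<comment> \<open>The first argument is 0 and gives too little. The second is -1/(2i - 1), and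
      integrality of its double makes 2i - 1 divide 2, so \<open>i = 1\<close> and
      \<open>d = 2\<close>.\<close>
    case 2
    then have "4 * int i = 2 * int d"
      using z_eq by simp
    then have di: "d = 2 * i"
      by linarith
    then have gt: "d > 1"
      using i by simp
    define t where "t = 1 - 4 * real i * (real d - real i) / (real d * (real d - 1))"
    have t: "t = - 1 / (2 * real i - 1)"
      using i unfolding t_def di by (simp add: field_simps)
    have "2 * t \<in> \<int>"
      using two[OF gt] n by (intro two_times_Ints_if_cheb[of _ n]) (simp_all add: t flip: t_def)
    then obtain m :: int where m: "2 * t = of_int m"
      by (rule Ints_cases)
    then have "of_int m * (2 * real i - 1) = - 2"
      using i by (simp add: t field_simps)
    then have "real_of_int (m * (2 * int i - 1)) = real_of_int (- 2)"
      by simp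
    then have "m * (2 * int i - 1) = - 2"
      by (simp only: of_int_eq_iff)
    then have dvd: "2 * int i - 1 dvd 2"
      by (metis dvd_minus_iff dvd_triv_right)
    then have "2 * int i - 1 \<le> 2"
      by (rule zdvd_imp_le) simp
    then show ?thesis
      using di i by auto
  next
    case 3
    then have "1 - 2 * real i / real d = - (1/2)"
      using z d by (simp add: field_simps)
    then show ?thesis
      using one cheb_minus_half_neq by metis
  next
    case 4
    then show ?thesis
      using z_eq by simp
  qed
qed

text \<open>For the empty \<open>M\<close> the eigenfunction is the constant 1, so the neighbour sum
  counts neighbours.\<close>

lemma out_degree_hamming_dist_graph:
  assumes "finite F" and "1 \<le> i" and x: "x \<in> pverts (hamming_dist_graph d F i)"
  shows "real (out_degree (with_proj (hamming_dist_graph d F i)) x) = krawtchouk d (card F) i 0"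
  using sum_neighbours_krawtchouk[OF assms(1) x, of "\<lambda>_. 0" "{}"]
  by (simp add: out_degree_eq_card[OF pair_graph_hamming_dist_graph[OF assms(1,2)]])

text \<open>The number is the degree of a constant word, and no vertex is isolated.\<close>

lemma krawtchouk_0_pos:
  assumes F: "finite F" "card F \<ge> 2" and i: "1 \<le> i" "i \<le> d"
  shows "krawtchouk d (card F) i 0 > 0"
proof -
  let ?H = "hamming_dist_graph d F i"
  interpret pair_graph ?H
    by (rule pair_graph_hamming_dist_graph[OF F(1) i(1)])
  obtain c where "c \<in> F"
    using F by fastforce
  then have x: "replicate d c \<in> pverts ?H"
    by (auto simp: pverts_hamming_dist_graph)
  obtain y where "(replicate d c, y) \<in> parcs ?H"
    using hamming_dist_graph_no_isolated[OF F(2) i(2) x] by blast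
  moreover have "finite {y. (replicate d c, y) \<in> parcs ?H}"
    by (rule finite_subset[of _ "snd ` parcs ?H"]) force+
  ultimately have "out_degree (with_proj ?H) (replicate d c) > 0"
    unfolding out_degree_eq_card[OF pair_graph_axioms] by (auto simp: card_gt_0_iff)
  then show ?thesis
    using out_degree_hamming_dist_graph[OF F(1) i(1) x] by simp
qed

section \<open>Necessity of the conditions on the parameters\<close>

lemma pverts_hamming_neq:
  assumes "u \<in> pverts (hamming_dist_graph d F i)" "v \<in> pverts (hamming_dist_graph d F i)" "u \<noteq> v"
  obtains k where "k < d" "u ! k \<in> F" "v ! k \<in> F" "u ! k \<noteq> v ! k"
proof -
  have uv: "length u = d" "set u \<subseteq> F" "length v = d" "set v \<subseteq> F"
    using assms(1,2) by (auto simp: pverts_hamming_dist_graph)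
  then obtain k where k: "k < d" "u ! k \<noteq> v ! k"
    using assms(3) nth_equalityI[of u v] by auto
  then show thesis
    using that uv nth_mem[of k u] nth_mem[of k v] by (metis subsetD)
qed

text \<open>This collects what necessity requires from the walk: real identities for all
  \<open>s\<close> and \<open>M\<close> at once, with the phase eliminated.\<close>

lemma perfect_state_transfer_hamming_cheb:
  fixes F :: "'b set"
  assumes F: "finite F" "card F \<ge> 2" and i: "1 \<le> i" "i \<le> d"
    and pst: "perfect_state_transfer (hamming_dist_graph d F i)"
  obtains u v n where "u \<in> pverts (hamming_dist_graph d F i)" "v \<in> pverts (hamming_dist_graph d F i)"
    "u \<noteq> v" "n > 0"
    "\<forall>s M. (\<Sum>c\<in>F. s c) = 0 \<longrightarrow> M \<subseteq> {..<d} \<longrightarrow>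
      cheb n (krawtchouk d (card F) i (card M) / krawtchouk d (card F) i 0) * (\<Prod>k\<in>M. s (u ! k))
        = (\<Prod>k\<in>M. s (v ! k) :: real)"
proof -
  let ?H = "hamming_dist_graph d F i"
  let ?\<kappa> = "krawtchouk d (card F) i"
  obtain u v n \<gamma> where uv: "u \<in> pverts ?H" "v \<in> pverts ?H" "u \<noteq> v" "n > 0"
    and U: "\<And>a. a \<in> parcs ?H \<Longrightarrow>
      (mat_vec (parcs ?H) (grover_matrix ?H) ^^ n) (vertex_state ?H u) a = \<gamma> * vertex_state ?H v a"
    using pst unfolding perfect_state_transfer_def by blast
  define K where "K = out_degree (with_proj ?H) u"
  have K: "real K = ?\<kappa> 0"
    unfolding K_def by (rule out_degree_hamming_dist_graph[OF F(1) i(1) uv(1)])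
  have deg: "out_degree (with_proj ?H) x = K" if "x \<in> pverts ?H" for x
    using out_degree_hamming_dist_graph[OF F(1) i(1) that] K by simp
  have pos: "K > 0"
    using krawtchouk_0_pos[OF F i] K by simp
  have transfer: "complex_of_real (cheb n (?\<kappa> (card M) / ?\<kappa> 0) * (\<Prod>k\<in>M. s (u ! k)))
      = \<gamma> * complex_of_real (\<Prod>k\<in>M. s (v ! k))"
    if s: "(\<Sum>c\<in>F. s c) = 0" and M: "M \<subseteq> {..<d}" for s M
  proof -
    define f where "f = (\<lambda>x. complex_of_real (\<Prod>k\<in>M. s (x ! k)))"
    have "(\<Sum>y | (x, y) \<in> parcs ?H. f y)
        = of_nat K * complex_of_real (?\<kappa> (card M) / ?\<kappa> 0) * f x" if x: "x \<in> pverts ?H" for x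
    proof -
      have "(\<Sum>y | (x, y) \<in> parcs ?H. f y) = complex_of_real (?\<kappa> (card M) * (\<Prod>k\<in>M. s (x ! k)))"
        unfolding f_def of_real_sum[symmetric] sum_neighbours_krawtchouk[OF F(1) x s M] ..
      also have "?\<kappa> (card M) = real K * (?\<kappa> (card M) / ?\<kappa> 0)"
        using pos unfolding K[symmetric] by simp
      finally show ?thesis
        unfolding f_def of_real_mult by simp
    qed
    from perfect_state_transfer_cheb[OF pair_graph_hamming_dist_graph[OF F(1) i(1)] deg pos
        uv(1,2) U this]
    show ?thesis
      unfolding f_def cheb_of_real of_real_mult .
  qed
  \<comment> \<open>The constant eigenfunction has eigenvalue 1, where every Chebyshev polynomial
    takes the value 1.\<close>
  have "\<gamma> = 1"
    using transfer[of "\<lambda>_. 0" "{}"] pos K by simp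
  then show thesis
    using that[OF uv] transfer by (simp only: mult_1 of_real_eq_iff) blast
qed

lemma perfect_state_transfer_hamming_imp:
  fixes F :: "'b set"
  assumes F: "finite F" and i: "1 \<le> i" "i \<le> d"
    and pst: "perfect_state_transfer (hamming_dist_graph d F i)"
  shows "card F = 2 \<and> (i = d \<or> d = 2 \<and> i = 1)"
proof -
  let ?H = "hamming_dist_graph d F i"
  have F2: "card F \<ge> 2"
  proof -
    obtain u v where "u \<in> pverts ?H" "v \<in> pverts ?H" "u \<noteq> v"
      using pst unfolding perfect_state_transfer_def by blast
    then obtain k where "u ! k \<in> F" "v ! k \<in> F" "u ! k \<noteq> v ! k"
      by (rule pverts_hamming_neq)
    then have "card {u ! k, v ! k} \<le> card F"
      using F by (intro card_mono) auto
    then show ?thesis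
      using \<open>u ! k \<noteq> v ! k\<close> by simp
  qed
  obtain u v n where uv: "u \<in> pverts ?H" "v \<in> pverts ?H" "u \<noteq> v" and n: "n > 0"
    and cheb: "\<forall>s M. (\<Sum>c\<in>F. s c) = 0 \<longrightarrow> M \<subseteq> {..<d} \<longrightarrow>
      cheb n (krawtchouk d (card F) i (card M) / krawtchouk d (card F) i 0) * (\<Prod>k\<in>M. s (u ! k))
        = (\<Prod>k\<in>M. s (v ! k) :: real)"
    by (rule perfect_state_transfer_hamming_cheb[OF F F2 i pst])
  obtain k where k: "k < d" "u ! k \<in> F" "v ! k \<in> F" "u ! k \<noteq> v ! k"
    using uv by (rule pverts_hamming_neq)
  have card: "card F = 2"
  proof (rule ccontr)
    assume "card F \<noteq> 2"
    then have "\<not> F \<subseteq> {u ! k, v ! k}"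
      using F2 k(4) card_mono[of "{u ! k, v ! k}" F] by auto
    then obtain c where c: "c \<in> F" "c \<noteq> u ! k" "c \<noteq> v ! k"
      by blast
    \<comment> \<open>This function vanishes at \<open>u ! k\<close> and is 1 at
      \<open>v ! k\<close>, so the identity for \<open>{k}\<close> reads 0 = 1.\<close>
    define s where "s = (\<lambda>x. (if x = v ! k then 1 else 0) - (if x = c then 1 else 0) :: real)"
    have "(\<Sum>x\<in>F. s x) = 0"
      using F c k by (simp add: s_def sum_subtractf)
    from cheb[rule_format, OF this, of "{k}"] show False
      using c k by (simp add: s_def)
  qed
  define s where "s = (\<lambda>x. if x = u ! k then 1 else - 1 :: real)"
  have F_eq: "F = {u ! k, v ! k}"
    using card k F by (intro card_subset_eq[symmetric]) auto
  have s: "(\<Sum>x\<in>F. s x) = 0"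
    unfolding F_eq using k by (simp add: s_def)
  let ?T = "\<lambda>w. cheb n (krawtchouk d 2 i w / krawtchouk d 2 i 0)"
  have T1: "?T 1 = - 1"
    using cheb[rule_format, OF s, of "{k}"] k card by (simp add: s_def)
  have T2: "?T 2 = 1" if "d > 1"
  proof -
    \<comment> \<open>The eigenvalue depends only on the size of \<open>M\<close>, so the value -1
      found at \<open>k\<close> holds at every coordinate: \<open>u\<close> and \<open>v\<close>
      differ everywhere. For two coordinates the sign changes cancel.\<close>
    have flip: "s (v ! l) = - s (u ! l)" if "l < d" for l
      using cheb[rule_format, OF s, of "{l}"] that T1 card by simp
    have "?T 2 * (s (u ! 0) * s (u ! 1)) = s (v ! 0) * s (v ! 1)"
      using cheb[rule_format, OF s, of "{0, 1}"] that card by (simp add: numeral_2_eq_2)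
    also have "\<dots> = s (u ! 0) * s (u ! 1)"
      using flip that by simp
    finally show ?thesis
      by (auto simp: s_def split: if_splits)
  qed
  have e: "real (d choose i) > 0"
    using i by simp
  have "krawtchouk d 2 i 1 / krawtchouk d 2 i 0 = 1 - 2 * real i / real d"
    using krawtchouk_2_1[of i d] krawtchouk_2_0[of i d] i e by (simp add: field_simps)
  moreover have "krawtchouk d 2 i 2 / krawtchouk d 2 i 0
      = 1 - 4 * real i * (real d - real i) / (real d * (real d - 1))" if "d > 1"
  proof -
    have "real d * (real d - 1) \<noteq> 0"
      using that by simp
    then have "krawtchouk d 2 i 2 / krawtchouk d 2 i 0
        = (real d * (real d - 1) * krawtchouk d 2 i 2) / (real d * (real d - 1) * real (d choose i))"
      unfolding krawtchouk_2_0[OF i(2)] by simp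
    also have "\<dots> = (real d * (real d - 1) - 4 * real i * (real d - real i)) / (real d * (real d - 1))"
      unfolding krawtchouk_2_2[OF i(1) that] using e by simp
    also have "\<dots> = 1 - 4 * real i * (real d - real i) / (real d * (real d - 1))"
      using \<open>real d * (real d - 1) \<noteq> 0\<close> by (simp add: diff_divide_distrib)
    finally show ?thesis .
  qed
  ultimately show ?thesis
    using cheb_hamming_arithmetic[OF i n] T1 T2 card by metis
qed

section \<open>Sufficiency: the perfect matching and the 4-cycle\<close>

lemma perfect_state_transfer_hamming_2:
  fixes F :: "'b set"
  assumes card: "card F = 2" and i: "1 \<le> i" "i \<le> d" and di: "i = d \<or> d = 2 \<and> i = 1"
  shows "perfect_state_transfer (hamming_dist_graph d F i)"
proof -
  let ?H = "hamming_dist_graph d F i"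
  have F: "finite F"
    using card card.infinite by fastforce
  note G = pair_graph_hamming_dist_graph[OF F i(1), of d]
  interpret pair_graph ?H
    by (rule G)
  obtain a b where ab: "F = {a, b}" "a \<noteq> b"
    using card by (auto simp: card_2_iff)
  \<comment> \<open>Antipodal words, as necessity demands of any pair with transfer.\<close>
  define u v where "u = replicate d a" and "v = replicate d b"
  have uv: "u \<in> pverts ?H" "v \<in> pverts ?H"
    by (auto simp: pverts_hamming_dist_graph u_def v_def ab)
  have "u \<noteq> v"
    using i ab by (auto simp: u_def v_def)
  have deg: "out_degree (with_proj ?H) x = d choose i" if "x \<in> pverts ?H" for x
    using out_degree_hamming_dist_graph[OF F i(1) that] krawtchouk_2_0[OF i(2)] card by simp
  have pos: "d choose i > 0"
    using i by simp
  let ?U = "mat_vec (parcs ?H) (grover_matrix ?H)"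
  have U1: "?U (vertex_state ?H u) e = (if fst e = u then 1 / complex_of_real (sqrt (d choose i)) else 0)"
    if "e \<in> parcs ?H" for e
    using grover_vertex_state[OF G deg pos uv(1) that] by simp
  have v_state: "vertex_state ?H v e = (if snd e = v then 1 / complex_of_real (sqrt (d choose i)) else 0)" for e
    using vertex_state_eq[OF G uv(2), of e] deg[OF uv(2)] by simp
  from di have "\<exists>n>0. \<forall>e\<in>parcs ?H. (?U ^^ n) (vertex_state ?H u) e = 1 * vertex_state ?H v e"
  proof
    assume "i = d"
    \<comment> \<open>Over two letters, differing everywhere means being complementary. Hence the
      arcs leaving \<open>u\<close> are those entering \<open>v\<close>, and one step of the walk
      suffices.\<close>
    have "fst e = u \<longleftrightarrow> snd e = v" if "e \<in> parcs ?H" for e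
    proof -
      obtain x y where e: "e = (x, y)"
        by fastforce
      have xy: "length x = d" "length y = d" "set x \<subseteq> F" "set y \<subseteq> F"
        and c: "card {k. k < d \<and> x ! k \<noteq> y ! k} = d"
        using that unfolding e parcs_hamming_dist_graph pverts_hamming_dist_graph \<open>i = d\<close> by auto
      have "{k. k < d \<and> x ! k \<noteq> y ! k} = {..<d}"
        using c by (intro card_subset_eq) auto
      then have neq: "x ! k \<noteq> y ! k" if "k < d" for k
        using that by auto
      have mem: "x ! k \<in> {a, b}" "y ! k \<in> {a, b}" if "k < d" for k
        using that xy nth_mem[of k x] nth_mem[of k y] unfolding ab(1) by (metis subsetD)+
      have "x ! k = a \<longleftrightarrow> y ! k = b" if "k < d" for k
        using neq[OF that] mem[OF that] ab(2) by auto
      moreover have "x = u \<longleftrightarrow> (\<forall>k<d. x ! k = a)" "y = v \<longleftrightarrow> (\<forall>k<d. y ! k = b)"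
        using xy by (auto simp: u_def v_def list_eq_iff_nth_eq)
      ultimately show ?thesis
        unfolding e by simp
    qed
    then show ?thesis
      by (intro exI[of _ 1]) (simp add: U1 v_state)
  next
    assume "d = 2 \<and> i = 1"
    then have [simp]: "d = 2" "i = 1"
      by auto
    have adj: "([p, r], [p', r']) \<in> parcs ?H \<longleftrightarrow>
        {p, r, p', r'} \<subseteq> {a, b} \<and> (p \<noteq> p') \<noteq> (r \<noteq> r')" for p r p' r'
    proof -
      have "{k. k < d \<and> [p, r] ! k \<noteq> [p', r'] ! k}
          = (if p \<noteq> p' then {0} else {}) \<union> (if r \<noteq> r' then {1} else {})"
        by (auto simp: less_2_cases_iff nth_Cons')
      then have "card {k. k < d \<and> [p, r] ! k \<noteq> [p', r'] ! k} = of_bool (p \<noteq> p') + of_bool (r \<noteq> r')"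
        by simp
      then show ?thesis
        unfolding parcs_hamming_dist_graph pverts_hamming_dist_graph by (simp add: ab(1))
    qed
    have u2: "u = [a, a]" and v2: "v = [b, b]"
      by (simp_all add: u_def v_def numeral_2_eq_2)
    have "?U (?U (vertex_state ?H u)) e = vertex_state ?H v e" if "e \<in> parcs ?H" for e
    proof -
      obtain x y where "e = (x, y)"
        by fastforce
      moreover have "length x = 2" "length y = 2"
        using that unfolding \<open>e = (x, y)\<close> parcs_hamming_dist_graph pverts_hamming_dist_graph by auto
      ultimately obtain p r p' r' where e: "e = ([p, r], [p', r'])"
        by (auto simp: length_Suc_conv numeral_2_eq_2)
      \<comment> \<open>Here the degree is 2, so the coefficient 2/K is 1. An arc that starts at a
        neighbour of \<open>u\<close> ends in \<open>u\<close> or in \<open>v\<close>. Subtracting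
        the arcs into \<open>u\<close> leaves those into \<open>v\<close>.\<close>
      have eq: "(if (u, fst e) \<in> parcs ?H then 1 else 0) - (if snd e = u then 1 else 0)
          = (if snd e = v then 1 else 0 :: complex)"
        using that ab(2) unfolding e fst_conv snd_conv u2 v2 adj by auto
      have "?U (?U (vertex_state ?H u)) e
          = ((if (u, fst e) \<in> parcs ?H then 2 / of_nat (d choose i) else 0)
              - (if snd e = u then 1 else 0)) / complex_of_real (sqrt (d choose i))"
        by (rule grover_grover_vertex_state[OF G deg pos uv(1) that])
      also have "2 / of_nat (d choose i) = (1 :: complex)"
        by simp
      finally show ?thesis
        unfolding eq v_state by simp
    qed
    then show ?thesis
      by (intro exI[of _ 2]) (simp add: numeral_2_eq_2)
  qed
  then obtain n where "n > 0"
    "\<forall>e\<in>parcs ?H. (?U ^^ n) (vertex_state ?H u) e = 1 * vertex_state ?H v e"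
    by blast
  then show ?thesis
    unfolding perfect_state_transfer_def using uv \<open>u \<noteq> v\<close>
    by (intro bexI[OF _ uv(1)] bexI[OF _ uv(2)] conjI exI[of _ n] exI[of _ 1]) simp_all
qed

theorem theorem3p10:
  fixes F :: "'a set" and d q i :: nat
  assumes "finite F" and "card F = q"
    and "d > 0" and "q > 0"
    and "1 \<le> i" and "i \<le> d"
  shows "perfect_state_transfer (hamming_dist_graph d F i) \<longleftrightarrow>
           (d, q, i) = (d, 2, d) \<or> (d, q, i) = (2, 2, 1)"
  using perfect_state_transfer_hamming_imp[OF assms(1,5,6)]
    perfect_state_transfer_hamming_2[OF _ assms(5,6)] assms(2) by auto

end
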